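(* Let $D$ be an infinite, connected, locally finite, distance-transitive digraph with no directed cycles. If $D$ is weakly descendant-homogeneous, then $D$ has property $Z$.
   Context: A digraph $D$ has a vertex set and an edge set $E(D)\subseteq D\times D$ with no loops; subdigraphs are full induced subdigraphs. For an integer $s\ge 0$, an $s$-arc from $u$ to $v$ is a sequence $u_0\dots u_s$ of vertices with $u_0=u$, $u_s=v$, $(u_i,u_{i+1})\in E(D)$ for $0\le i<s$, and $u_{i-1}\ne u_{i+1}$ for $0<i<s$. $\mathrm{desc}(u)$ is the set of vertices reachable from $u$ by an $s$-arc for some $s\ge 0$, and for a set $X$ of vertices $\mathrm{desc}(X)=\bigcup_{x\in X}\mathrm{desc}(x)$. $D$ is locally finite if every vertex has finite in-valency and finite out-valency. $D$ is distance-transitive if for every $s\ge0$, $\mathrm{Aut}(D)$ is transitive on ordered pairs $(u,v)$ for which there is an $s$-arc from $u$ to $v$ but no $t$-arc for any $t<s$. A directed cycle is a sequence $u_0,\dots,u_n=u_0$ ($n\ge1$) with $(u_i,u_{i+1})\in E(D)$ for all $i<n$. $D$ is weakly descendant-homogeneous if it is vertex transitive and, for any two finite sets $X,Y$ of vertices and any isomorphism $f$ from the subdigraph induced on $\mathrm{desc}(X)$ to the subdigraph induced on $\mathrm{desc}(Y)$, there is an automorphism of $D$ agreeing with $f$ on $X$. $D$ has property $Z$ if there is a surjective map $f$ from the vertex set of $D$ onto $\mathbb{Z}$ with $f(v)=f(u)+1$ for every edge $(u,v)$. *)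

theory Defs
  imports "Graph_Theory.Graph_Theory"
begin

text \<open>A digraph with edge set contained in \<open>D \<times> D\<close> and without loops is a
  \<^locale>\<open>pair_loopfree_digraph\<close>. The notions below are stated for arbitrary
  \<open>pre_digraph\<close>s, so that they also apply to induced subdigraphs \<open>G \<restriction> S\<close>.\<close>

definition s_arc :: "('a, 'b) pre_digraph \<Rightarrow> nat \<Rightarrow> 'a \<Rightarrow> 'a list \<Rightarrow> 'a \<Rightarrow> bool" where
  "s_arc G s u us v \<longleftrightarrow>
     length us = Suc s \<and> set us \<subseteq> verts G \<and> us ! 0 = u \<and> us ! s = v \<and>
     (\<forall>i. i < s \<longrightarrow> us ! i \<rightarrow>\<^bsub>G\<^esub> us ! Suc i) \<and>
     (\<forall>i. 0 < i \<and> i < s \<longrightarrow> us ! (i - 1) \<noteq> us ! (i + 1))"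

definition desc :: "('a, 'b) pre_digraph \<Rightarrow> 'a \<Rightarrow> 'a set" where
  "desc G u = {v. \<exists>s us. s_arc G s u us v}"

definition desc_set :: "('a, 'b) pre_digraph \<Rightarrow> 'a set \<Rightarrow> 'a set" where
  "desc_set G X = (\<Union>x\<in>X. desc G x)"

definition locally_finite_digraph :: "('a, 'b) pre_digraph \<Rightarrow> bool" where
  "locally_finite_digraph G \<longleftrightarrow>
     (\<forall>v\<in>verts G. finite (in_arcs G v) \<and> finite (out_arcs G v))"

text \<open>Only the values of \<open>f\<close> on the vertices of \<open>G\<close> matter. In a digraph without parallel
  arcs the vertex map determines the arc map, so the latter is left out; see
  \<open>vertex_isomorphism_iff\<close> for the relation to \<open>digraph_isomorphism\<close>.\<close>

definition vertex_isomorphism ::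
    "('a \<Rightarrow> 'c) \<Rightarrow> ('a, 'b) pre_digraph \<Rightarrow> ('c, 'd) pre_digraph \<Rightarrow> bool" where
  "vertex_isomorphism f G H \<longleftrightarrow>
     bij_betw f (verts G) (verts H) \<and>
     (\<forall>u\<in>verts G. \<forall>v\<in>verts G. u \<rightarrow>\<^bsub>G\<^esub> v \<longleftrightarrow> f u \<rightarrow>\<^bsub>H\<^esub> f v)"

lemma vertex_isomorphism_iff:
  fixes G :: "'a pair_pre_digraph" and H :: "'c pair_pre_digraph"
  assumes "pair_wf_digraph G" "pair_wf_digraph H"
  shows "vertex_isomorphism f G H \<longleftrightarrow>
    (\<exists>h. pre_digraph.digraph_isomorphism G h \<and> iso_verts h = f \<and> with_proj H = app_iso h G)"
proof
  interpret G: pair_wf_digraph G by fact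
  interpret H: pair_wf_digraph H by fact
  assume f: "vertex_isomorphism f G H"
  let ?h = "\<lparr>iso_verts = f, iso_arcs = map_prod f f, iso_head = snd, iso_tail = fst\<rparr>"
  have inj: "inj_on f (pverts G)" and im: "f ` pverts G = pverts H"
    using f by (auto simp: vertex_isomorphism_def bij_betw_def)
  have arcs: "(u, v) \<in> parcs G \<longleftrightarrow> (f u, f v) \<in> parcs H"
    if "u \<in> pverts G" "v \<in> pverts G" for u v
    using f that by (auto simp: vertex_isomorphism_def)
  have sub: "parcs G \<subseteq> pverts G \<times> pverts G"
    using G.in_arcsD1 G.in_arcsD2 by auto
  have "inj_on (map_prod f f) (parcs G)"
    using map_prod_inj_on[OF inj inj] sub by (rule inj_on_subset)
  then have "pre_digraph.digraph_isomorphism G ?h"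
    using inj G.wf_digraph by (auto simp: pre_digraph.digraph_isomorphism_def)
  moreover have "map_prod f f ` parcs G = parcs H"
  proof (intro equalityI subsetI)
    fix e assume "e \<in> map_prod f f ` parcs G"
    then show "e \<in> parcs H" using arcs sub by auto
  next
    fix e assume e: "e \<in> parcs H"
    obtain x y where xy: "e = (x, y)" by (cases e)
    then have "x \<in> f ` pverts G" "y \<in> f ` pverts G"
      using e im H.in_arcsD1 H.in_arcsD2 by auto
    then obtain u v where "u \<in> pverts G" "v \<in> pverts G" "x = f u" "y = f v" by blast
    then show "e \<in> map_prod f f ` parcs G" using arcs e xy by force
  qed
  then have "with_proj H = app_iso ?h G"
    using im by (simp add: app_iso_def with_proj_def)
  ultimately show "\<exists>h. pre_digraph.digraph_isomorphism G h \<and> iso_verts h = f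
      \<and> with_proj H = app_iso h G"
    by (intro exI[of _ ?h]) simp
next
  interpret G: pair_wf_digraph G by fact
  assume "\<exists>h. pre_digraph.digraph_isomorphism G h \<and> iso_verts h = f
      \<and> with_proj H = app_iso h G"
  then obtain h where h: "pre_digraph.digraph_isomorphism G h" and f: "iso_verts h = f"
    and H: "with_proj H = app_iso h G" by blast
  have inj: "inj_on f (pverts G)"
    using h f by (auto simp: pre_digraph.digraph_isomorphism_def)
  have pv: "pverts H = f ` pverts G" and pa: "parcs H = iso_arcs h ` parcs G"
    and ht: "iso_tail h = fst" "iso_head h = snd"
    using H f by (simp_all add: app_iso_def with_proj_def)
  have "iso_arcs h e = map_prod f f e" if "e \<in> parcs G" for e
    using h that ht f
    by (cases e) (auto simp: pre_digraph.digraph_isomorphism_def prod_eq_iff)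
  then have pa': "parcs H = map_prod f f ` parcs G" using pa by auto
  have "(u, v) \<in> parcs G \<longleftrightarrow> (f u, f v) \<in> parcs H" if "u \<in> pverts G" "v \<in> pverts G" for u v
  proof
    assume "(f u, f v) \<in> parcs H"
    then obtain u' v' where "(u', v') \<in> parcs G" "f u' = f u" "f v' = f v"
      using pa' by auto
    with inj that show "(u, v) \<in> parcs G"
      using G.in_arcsD1 G.in_arcsD2 by (metis inj_onD)
  qed (use pa' in force)
  then show "vertex_isomorphism f G H"
    using inj pv by (auto simp: vertex_isomorphism_def bij_betw_def)
qed

abbreviation automorphism :: "('a \<Rightarrow> 'a) \<Rightarrow> ('a, 'b) pre_digraph \<Rightarrow> bool" where
  "automorphism g G \<equiv> vertex_isomorphism g G G"

definition vertex_transitive :: "('a, 'b) pre_digraph \<Rightarrow> bool" where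
  "vertex_transitive G \<longleftrightarrow>
     (\<forall>u\<in>verts G. \<forall>v\<in>verts G. \<exists>g. automorphism g G \<and> g u = v)"

definition at_distance :: "('a, 'b) pre_digraph \<Rightarrow> nat \<Rightarrow> 'a \<Rightarrow> 'a \<Rightarrow> bool" where
  "at_distance G s u v \<longleftrightarrow>
     (\<exists>us. s_arc G s u us v) \<and> (\<forall>t<s. \<not> (\<exists>us. s_arc G t u us v))"

definition distance_transitive :: "('a, 'b) pre_digraph \<Rightarrow> bool" where
  "distance_transitive G \<longleftrightarrow>
     (\<forall>s u v u' v'. at_distance G s u v \<and> at_distance G s u' v' \<longrightarrow>
        (\<exists>g. automorphism g G \<and> g u = u' \<and> g v = v'))"

text \<open>Unlike \<open>pre_digraph.cycle\<close>, a directed cycle may repeat vertices.\<close>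

definition directed_cycle :: "('a, 'b) pre_digraph \<Rightarrow> 'a list \<Rightarrow> bool" where
  "directed_cycle G us \<longleftrightarrow>
     (\<exists>n\<ge>1. length us = Suc n \<and> us ! n = us ! 0 \<and>
        (\<forall>i<n. us ! i \<rightarrow>\<^bsub>G\<^esub> us ! Suc i))"

definition weakly_descendant_homogeneous :: "('a, 'b) pre_digraph \<Rightarrow> bool" where
  "weakly_descendant_homogeneous G \<longleftrightarrow>
     vertex_transitive G \<and>
     (\<forall>X Y f. finite X \<and> X \<subseteq> verts G \<and> finite Y \<and> Y \<subseteq> verts G \<and>
        vertex_isomorphism f (G \<restriction> desc_set G X) (G \<restriction> desc_set G Y) \<longrightarrow>
        (\<exists>g. automorphism g G \<and> (\<forall>x\<in>X. g x = f x)))"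

definition property_Z :: "('a, 'b) pre_digraph \<Rightarrow> bool" where
  "property_Z G \<longleftrightarrow>
     (\<exists>f :: 'a \<Rightarrow> int. f ` verts G = UNIV \<and> (\<forall>u v. u \<rightarrow>\<^bsub>G\<^esub> v \<longrightarrow> f v = f u + 1))"

end

theory Submission
  imports Defs
begin

text \<open>
  In an acyclic distance-transitive digraph of finite out-valency all walks between two given
  vertices have the same length: otherwise, for the least distance \<open>s\<close> admitting a longer walk,
  every vertex of the finite sphere of radius \<open>s\<close> around \<open>u\<close> would have a proper ancestor in
  the same sphere.

  Any two vertices \<open>x\<close>, \<open>y\<close> have a common descendant: if \<open>desc x\<close> and \<open>desc y\<close> are disjoint,
  then for every \<open>x' \<in> desc x\<close> an isomorphism \<open>desc x \<rightarrow> desc x'\<close> glued with the identity of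
  \<open>desc y\<close> yields an automorphism fixing \<open>y\<close> and taking \<open>x\<close> to \<open>x'\<close>. So the infinite set
  \<open>desc x\<close> lies in a single orbit of the stabiliser of \<open>y\<close>, but such orbits are finite by
  connectedness and local finiteness.

  Hence the level of \<open>x\<close> relative to a base vertex \<open>b\<close> can be read off at any common descendant
  \<open>z\<close> as \<open>d b z - d x z\<close>; two choices of \<open>z\<close> are compared at a common descendant of both.
\<close>

section \<open>Spheres and uniqueness of walk lengths for an abstract relation\<close>

definition layer :: "'a rel \<Rightarrow> nat \<Rightarrow> 'a \<Rightarrow> 'a set" where
  "layer R s u = {v. (u, v) \<in> R ^^ s \<and> (\<forall>t<s. (u, v) \<notin> R ^^ t)}"

text \<open>Each edge increases the distance from \<open>u\<close> by at most one, so a walk ending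
  at distance at least \<open>s\<close> cannot skip the sphere of radius \<open>s\<close>.\<close>

lemma layer_on_walk:
  assumes "(u, v) \<in> R ^^ n" "\<forall>t<s. (u, v) \<notin> R ^^ t"
  shows "\<exists>w\<in>layer R s u. (w, v) \<in> R\<^sup>*"
  using assms
proof (induction n arbitrary: v)
  case 0
  then have "s = 0" by (metis gr0I)
  then show ?case using 0 by (auto simp: layer_def)
next
  case (Suc n)
  then obtain p where p: "(u, p) \<in> R ^^ n" "(p, v) \<in> R" by auto
  show ?case
  proof (cases "\<forall>t<s. (u, p) \<notin> R ^^ t")
    case True
    with Suc.IH p show ?thesis by (meson rtrancl.rtrancl_into_rtrancl)
  next
    case False
    then obtain t where t: "t < s" "(u, p) \<in> R ^^ t" by blast
    then have "(u, v) \<in> R ^^ Suc t" using p by auto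
    moreover have "Suc t = s" using t Suc.prems(2) calculation by (metis Suc_lessI)
    ultimately have "v \<in> layer R s u" using Suc.prems(2) by (auto simp: layer_def)
    then show ?thesis by blast
  qed
qed

lemma finite_relpow_Image:
  fixes R :: "'a rel"
  assumes "\<And>x. finite (R `` {x})"
  shows "finite ((R ^^ n) `` {u})"
proof (induction n)
  case (Suc n)
  have "(R ^^ Suc n) `` {u} = (\<Union>x\<in>(R ^^ n) `` {u}. R `` {x})" by auto
  then show ?case using Suc assms by simp
qed simp

text \<open>Assumption \<open>homog\<close> isolates what distance transitivity contributes: the set
  of walk lengths between two vertices depends only on their distance.\<close>

lemma relpow_length_unique:
  assumes acyc: "acyclic R" and fin: "\<And>x. finite (R `` {x})"
    and homog: "\<And>s t u v u' v'. v \<in> layer R s u \<Longrightarrow> v' \<in> layer R s u'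
      \<Longrightarrow> (u, v) \<in> R ^^ t \<Longrightarrow> (u', v') \<in> R ^^ t"
    and st: "(u, v) \<in> R ^^ s" "(u, v) \<in> R ^^ t"
  shows "s = t"
proof -
  have least: "\<exists>m\<le>n. y \<in> layer R m x" if "(x, y) \<in> R ^^ n" for x y n
  proof -
    let ?m = "LEAST m. (x, y) \<in> R ^^ m"
    have "(x, y) \<in> R ^^ ?m" using that by (rule LeastI)
    moreover have "?m \<le> n" using that by (rule Least_le)
    ultimately show ?thesis by (auto simp: layer_def dest: not_less_Least)
  qed
  \<comment> \<open>It is enough to compare every walk length with the distance; this is done by
    strong induction on the distance.\<close>
  have eq: "t = s" if "v \<in> layer R s u" "(u, v) \<in> R ^^ t" for s t u v
    using that
  proof (induction s arbitrary: u v t rule: less_induct)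
    case (less s)
    show ?case
    proof (rule ccontr)
      assume "t \<noteq> s"
      with less.prems have st: "s < t" by (auto simp: layer_def not_less_iff_gr_or_eq)
      then obtain t' where t': "t = Suc t'" by (cases t) auto
      let ?S = "layer R s u"
      have step: "\<exists>w'\<in>?S. (w', w) \<in> R\<^sup>+" if w: "w \<in> ?S" for w
      proof -
        \<comment> \<open>By \<open>homog\<close> the long walk to \<open>v\<close> has a
          counterpart to every vertex of the sphere; its last vertex but one is
          \<open>p\<close>.\<close>
        have "(u, w) \<in> R ^^ t" using homog less.prems w by blast
        then obtain p where p: "(u, p) \<in> R ^^ t'" "(p, w) \<in> R" using t' by auto
        \<comment> \<open>If \<open>p\<close> were closer than \<open>s\<close>, the induction
          hypothesis would make \<open>t'\<close> equal to its distance, but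
          \<open>t' \<ge> s\<close>. So the walk to \<open>p\<close> meets the sphere.\<close>
        have far: "\<forall>k<s. (u, p) \<notin> R ^^ k"
        proof (intro allI impI notI)
          fix k assume k: "k < s" "(u, p) \<in> R ^^ k"
          then obtain m where m: "m \<le> k" "p \<in> layer R m u" using least by blast
          then have "t' = m" using less.IH[of m p u t'] k p by auto
          then show False using st t' m k by auto
        qed
        then obtain w' where "w' \<in> ?S" "(w', p) \<in> R\<^sup>*" using layer_on_walk[OF p(1)] by blast
        then show ?thesis using p(2) by (meson rtrancl_into_trancl1)
      qed
      have finS: "finite ?S"
        by (rule finite_subset[OF _ finite_relpow_Image[OF fin, where n = s and u = u]])
          (auto simp: layer_def)
      have "acyclic (R\<^sup>+ \<inter> ?S \<times> ?S)"
        by (rule acyclic_subset[of "R\<^sup>+"]) (use acyc in \<open>auto simp: acyclic_def\<close>)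
      then have "wf (R\<^sup>+ \<inter> ?S \<times> ?S)" using finS by (intro finite_acyclic_wf) auto
      then obtain w where "w \<in> ?S" "\<And>w'. (w', w) \<in> R\<^sup>+ \<inter> ?S \<times> ?S \<Longrightarrow> w' \<notin> ?S"
        using less.prems(1) by (rule wfE_min) blast
      then show False using step by blast
    qed
  qed
  obtain m where "v \<in> layer R m u" using least st by blast
  then show ?thesis using eq st by metis
qed

section \<open>Arcs and descendants as powers of the edge relation\<close>

lemma acyclic_if_no_directed_cycle:
  fixes D :: "'a pair_pre_digraph"
  assumes "\<not> (\<exists>us. directed_cycle D us)"
  shows "acyclic (parcs D)"
  unfolding acyclic_def
proof (intro allI notI)
  fix x assume "(x, x) \<in> (parcs D)\<^sup>+"
  then obtain n where n: "n > 0" "(x, x) \<in> parcs D ^^ n" by (auto simp: trancl_power)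
  then obtain f where f: "f 0 = x" "f n = x" "\<forall>i<n. (f i, f (Suc i)) \<in> parcs D"
    by (auto simp: relpow_fun_conv)
  then have "directed_cycle D (map f [0..<Suc n])"
    unfolding directed_cycle_def using n
    by (intro exI[of _ n]) (auto simp: nth_append simp del: upt_Suc)
  then show False using assms by blast
qed

text \<open>The ban on backtracking is automatic, since a backtrack would close a directed 2-cycle.
  That \<open>u\<close> is a vertex matters for \<open>s = 0\<close>, where the power is the
  identity on the whole type.\<close>

lemma s_arc_iff_relpow:
  fixes D :: "'a pair_pre_digraph"
  assumes "pair_wf_digraph D" and acyc: "acyclic (parcs D)" and u: "u \<in> pverts D"
  shows "(\<exists>us. s_arc D s u us v) \<longleftrightarrow> (u, v) \<in> parcs D ^^ s"
proof
  assume "\<exists>us. s_arc D s u us v"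
  then show "(u, v) \<in> parcs D ^^ s" by (auto simp: s_arc_def relpow_fun_conv)
next
  interpret pair_wf_digraph D by fact
  assume "(u, v) \<in> parcs D ^^ s"
  then obtain f where f: "f 0 = u" "f s = v" "\<And>i. i < s \<Longrightarrow> (f i, f (Suc i)) \<in> parcs D"
    by (auto simp: relpow_fun_conv)
  have verts: "f i \<in> pverts D" if "i \<le> s" for i
    using that f u in_arcsD2 by (cases i) (auto simp: Suc_le_eq)
  have "f (i - 1) \<noteq> f (Suc i)" if "0 < i" "i < s" for i
  proof
    assume "f (i - 1) = f (Suc i)"
    moreover have "(f (i - 1), f i) \<in> parcs D" using f(3)[of "i - 1"] that by simp
    ultimately have "(f i, f i) \<in> (parcs D)\<^sup>+" using f(3)[of i] that by (metis trancl.simps)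
    then show False using acyc by (simp add: acyclic_def)
  qed
  then have "s_arc D s u (map f [0..<Suc s]) v"
    using f verts by (auto simp: s_arc_def simp del: upt_Suc)
  then show "\<exists>us. s_arc D s u us v" by blast
qed

lemma desc_eq_rtrancl_Image:
  fixes D :: "'a pair_pre_digraph"
  assumes "pair_wf_digraph D" "acyclic (parcs D)" "u \<in> pverts D"
  shows "desc D u = (parcs D)\<^sup>* `` {u}"
  using s_arc_iff_relpow[OF assms] by (auto simp: desc_def rtrancl_power)

section \<open>Automorphisms acting on walks and descendant sets\<close>

lemma automorphismD:
  fixes D :: "'a pair_pre_digraph"
  assumes "automorphism g D"
  shows "inj_on g (pverts D)" "g ` pverts D = pverts D"
    "\<And>u v. u \<in> pverts D \<Longrightarrow> v \<in> pverts D \<Longrightarrow> (g u, g v) \<in> parcs D \<longleftrightarrow> (u, v) \<in> parcs D"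
  using assms by (auto simp: vertex_isomorphism_def bij_betw_def)

lemma automorphism_relpow:
  fixes D :: "'a pair_pre_digraph"
  assumes "pair_wf_digraph D" and g: "automorphism g D" and uv: "(u, v) \<in> parcs D ^^ n"
  shows "(g u, g v) \<in> parcs D ^^ n"
  using uv
proof (induction n arbitrary: v)
  interpret pair_wf_digraph D by fact
  case (Suc n)
  then obtain p where "(u, p) \<in> parcs D ^^ n" "(p, v) \<in> parcs D" by auto
  moreover from this(2) have "(g p, g v) \<in> parcs D"
    using automorphismD(3)[OF g] in_arcsD1 in_arcsD2 by blast
  ultimately show ?case using Suc.IH by auto
qed simp

lemma automorphism_image_desc:
  fixes D :: "'a pair_pre_digraph"
  assumes wf: "pair_wf_digraph D" and g: "automorphism g D" and u: "u \<in> pverts D"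
  shows "g ` ((parcs D)\<^sup>* `` {u}) = (parcs D)\<^sup>* `` {g u}"
proof (intro equalityI subsetI)
  fix w assume "w \<in> g ` ((parcs D)\<^sup>* `` {u})"
  then show "w \<in> (parcs D)\<^sup>* `` {g u}"
    using automorphism_relpow[OF wf g] by (auto simp: rtrancl_power) blast
next
  interpret pair_wf_digraph D by fact
  fix w assume "w \<in> (parcs D)\<^sup>* `` {g u}"
  then have "(g u, w) \<in> (parcs D)\<^sup>*" by simp
  \<comment> \<open>No inverse automorphism is formed: a walk from \<open>g u\<close> is lifted edge
    by edge through surjectivity of \<open>g\<close>.\<close>
  then have "\<exists>v\<in>pverts D. (u, v) \<in> (parcs D)\<^sup>* \<and> w = g v"
  proof induction
    case base
    then show ?case using u by blast
  next
    case (step y z)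
    then obtain v where v: "v \<in> pverts D" "(u, v) \<in> (parcs D)\<^sup>*" "y = g v" by blast
    obtain v' where v': "v' \<in> pverts D" "z = g v'"
      using automorphismD(2)[OF g] step(2) in_arcsD2 by blast
    then have "(v, v') \<in> parcs D" using v step(2) automorphismD(3)[OF g] by blast
    then have "(u, v') \<in> (parcs D)\<^sup>*" using v(2) by simp
    then show ?case using v' by blast
  qed
  then show "w \<in> g ` ((parcs D)\<^sup>* `` {u})" by auto
qed

section \<open>Local finiteness and orbits of vertex stabilisers\<close>

lemma finite_neighbours:
  fixes D :: "'a pair_pre_digraph"
  assumes "pair_wf_digraph D" "locally_finite_digraph D"
  shows "finite (parcs D `` {x})" "finite ((parcs D)\<inverse> `` {x})"
proof -
  interpret pair_wf_digraph D by fact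
  have "parcs D `` {x} = snd ` out_arcs D x" "(parcs D)\<inverse> `` {x} = fst ` in_arcs D x"
    by (force simp: out_arcs_def in_arcs_def)+
  moreover have "finite (out_arcs D x)" "finite (in_arcs D x)"
  proof (atomize(full), cases "x \<in> pverts D")
    \<comment> \<open>Local finiteness speaks of vertices only; elements outside
      \<open>pverts D\<close> have no incident arcs at all.\<close>
    case False
    then have "out_arcs D x = {}" "in_arcs D x = {}"
      using in_arcsD1 in_arcsD2 by (auto simp: out_arcs_def in_arcs_def)
    then show "finite (out_arcs D x) \<and> finite (in_arcs D x)" by simp
  qed (use assms in \<open>auto simp: locally_finite_digraph_def\<close>)
  ultimately show "finite (parcs D `` {x})" "finite ((parcs D)\<inverse> `` {x})" by simp_all
qed

lemma connected_imp_rtrancl: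
  fixes D :: "'a pair_pre_digraph"
  assumes "pair_wf_digraph D" "connected D" "u \<in> pverts D" "v \<in> pverts D"
  shows "(u, v) \<in> (parcs D \<union> (parcs D)\<inverse>)\<^sup>*"
proof -
  interpret pair_wf_digraph D by fact
  have "u \<rightarrow>\<^sup>*\<^bsub>mk_symmetric D\<^esub> v"
    using assms by (auto simp: connected_def strongly_connected_def mk_symmetric_def)
  then have "(u, v) \<in> (arcs_ends (mk_symmetric D))\<^sup>*" by (rule reachable_rtranclI)
  moreover have "arcs_ends (mk_symmetric D) = parcs D \<union> (parcs D)\<inverse>"
    by (auto simp: mk_symmetric_def)
  ultimately show ?thesis by simp
qed

text \<open>Induction along an undirected walk from \<open>y\<close>, whose own orbit is a
  singleton: the orbit of the next vertex lies among the neighbours of the previous orbit.\<close>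

lemma finite_stabiliser_orbit:
  fixes D :: "'a pair_pre_digraph"
  assumes wf: "pair_wf_digraph D" and lf: "locally_finite_digraph D"
    and xy: "(y, x) \<in> (parcs D \<union> (parcs D)\<inverse>)\<^sup>*"
  shows "finite {g x | g. automorphism g D \<and> g y = y}"
  using xy
proof induction
  case base
  have "{g y | g. automorphism g D \<and> g y = y} \<subseteq> {y}" by auto
  then show ?case using finite_subset by blast
next
  interpret pair_wf_digraph D by fact
  case (step p x)
  let ?O = "\<lambda>x. {g x | g. automorphism g D \<and> g y = y}"
  have "?O x \<subseteq> (\<Union>q\<in>?O p. parcs D `` {q} \<union> (parcs D)\<inverse> `` {q})"
  proof
    fix z assume "z \<in> ?O x"
    then obtain g where g: "automorphism g D" "g y = y" "z = g x" by blast
    have "(g p, z) \<in> parcs D \<union> (parcs D)\<inverse>"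
      using step(2) g(3) automorphismD(3)[OF g(1)] in_arcsD1 in_arcsD2 by auto
    then show "z \<in> (\<Union>q\<in>?O p. parcs D `` {q} \<union> (parcs D)\<inverse> `` {q})" using g by blast
  qed
  moreover have "finite (\<Union>q\<in>?O p. parcs D `` {q} \<union> (parcs D)\<inverse> `` {q})"
    using step.IH finite_neighbours[OF wf lf] by blast
  ultimately show ?case by (rule finite_subset)
qed

section \<open>Common descendants\<close>

lemma rtrancl_closed:
  assumes "(a, b) \<in> R\<^sup>*" "a \<in> V" "Range R \<subseteq> V"
  shows "b \<in> V"
  using assms by (cases rule: rtrancl.cases) auto

text \<open>A finite acyclic set of descendants would contain a sink, contrary to
  \<open>out\<close>.\<close>

lemma infinite_rtrancl_Image:
  assumes acyc: "acyclic R" and closed: "Range R \<subseteq> V"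
    and out: "\<And>a. a \<in> V \<Longrightarrow> \<exists>b. (a, b) \<in> R" and x: "x \<in> V"
  shows "infinite (R\<^sup>* `` {x})"
proof
  let ?S = "R\<^sup>* `` {x}"
  assume fin: "finite ?S"
  have "acyclic (R \<inter> ?S \<times> ?S)" by (rule acyclic_subset[OF acyc]) auto
  then have "wf ((R \<inter> ?S \<times> ?S)\<inverse>)"
    using fin by (intro finite_acyclic_wf_converse) auto
  then obtain a where a: "a \<in> ?S" "\<And>b. (b, a) \<in> (R \<inter> ?S \<times> ?S)\<inverse> \<Longrightarrow> b \<notin> ?S"
    by (rule wfE_min[where Q = ?S and x = x]) auto
  from a(1) have "(x, a) \<in> R\<^sup>*" by simp
  then have "a \<in> V" using x closed by (rule rtrancl_closed)
  then obtain b where b: "(a, b) \<in> R" using out by blast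
  with a(1) have "b \<in> ?S" by (auto intro: rtrancl.rtrancl_into_rtrancl)
  then show False using a b by blast
qed

lemma vertex_isomorphism_glue:
  fixes D :: "'a pair_pre_digraph"
  assumes g: "automorphism g D"
    and A: "A \<subseteq> pverts D" "parcs D `` A \<subseteq> A" and A': "parcs D `` (g ` A) \<subseteq> g ` A"
    and B: "parcs D `` B \<subseteq> B"
    and disj: "A \<inter> B = {}" "g ` A \<inter> B = {}"
  shows "vertex_isomorphism (\<lambda>v. if v \<in> A then g v else v)
    (with_proj D \<restriction> (A \<union> B)) (with_proj D \<restriction> (g ` A \<union> B))" (is "vertex_isomorphism ?h _ _")
proof -
  have "inj_on g A" using automorphismD(1)[OF g] A(1) by (rule inj_on_subset)
  then have "bij_betw g A (g ` A)" by (rule inj_on_imp_bij_betw)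
  then have 1: "bij_betw ?h A (g ` A)"
    by (rule bij_betw_cong[THEN iffD1, rotated]) simp
  have 2: "bij_betw ?h B B"
    by (rule bij_betw_cong[THEN iffD1, OF _ bij_betw_id]) (use disj in auto)
  have bij: "bij_betw ?h (A \<union> B) (g ` A \<union> B)"
    using 1 2 disj(2) by (rule bij_betw_combine)
  have adj: "u \<rightarrow>\<^bsub>with_proj D \<restriction> S\<^esub> v \<longleftrightarrow> (u, v) \<in> parcs D \<and> u \<in> S \<and> v \<in> S" for u v S
    by (auto simp: arcs_ends_conv)
  have "(u, v) \<in> parcs D \<longleftrightarrow> (?h u, ?h v) \<in> parcs D" if "u \<in> A \<union> B" "v \<in> A \<union> B" for u v
  proof (cases "u \<in> A"; cases "v \<in> A")
    assume "u \<in> A" "v \<in> A"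
    then show ?thesis using automorphismD(3)[OF g, of u v] A by auto
  next
    assume *: "u \<in> A" "v \<notin> A"
    then have "(u, v) \<notin> parcs D" using A(2) by blast
    moreover have "(g u, v) \<notin> parcs D" using * that A' disj by blast
    ultimately show ?thesis using * by simp
  next
    assume *: "u \<notin> A" "v \<in> A"
    then have "(u, v) \<notin> parcs D" using that B disj by blast
    moreover have "(u, g v) \<notin> parcs D" using * that B disj by blast
    ultimately show ?thesis using * by simp
  qed simp
  moreover have "?h u \<in> g ` A \<union> B" if "u \<in> A \<union> B" for u
    using bij that by (rule bij_betw_apply)
  ultimately show ?thesis
    unfolding vertex_isomorphism_def using bij by (simp add: adj)
qed

lemma common_descendant:
  fixes D :: "'a pair_pre_digraph"
  assumes wf: "pair_wf_digraph D" and conn: "connected D" and lf: "locally_finite_digraph D"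
    and acyc: "acyclic (parcs D)" and wdh: "weakly_descendant_homogeneous D"
    and out: "\<And>u. u \<in> pverts D \<Longrightarrow> \<exists>v. (u, v) \<in> parcs D"
    and xy: "x \<in> pverts D" "y \<in> pverts D"
  shows "\<exists>z. (x, z) \<in> (parcs D)\<^sup>* \<and> (y, z) \<in> (parcs D)\<^sup>*"
proof (rule ccontr)
  interpret pair_wf_digraph D by fact
  have ran: "Range (parcs D) \<subseteq> pverts D" using in_arcsD2 by auto
  let ?d = "\<lambda>u. (parcs D)\<^sup>* `` {u}"
  assume "\<nexists>z. (x, z) \<in> (parcs D)\<^sup>* \<and> (y, z) \<in> (parcs D)\<^sup>*"
  then have disj: "?d x \<inter> ?d y = {}" by auto
  have sub: "?d u \<subseteq> pverts D" if "u \<in> pverts D" for u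
    using rtrancl_closed[OF _ that ran] by blast
  have closed: "parcs D `` ?d u \<subseteq> ?d u" for u
    by (auto intro: rtrancl.rtrancl_into_rtrancl)
  have vt: "vertex_transitive D" using wdh by (simp add: weakly_descendant_homogeneous_def)
  have "?d x \<subseteq> {g x | g. automorphism g D \<and> g y = y}"
  proof
    fix x' assume "x' \<in> ?d x"
    \<comment> \<open>Descendants of \<open>x'\<close> are descendants of \<open>x\<close>, so the
      image piece stays disjoint from \<open>?d y\<close>, as glueing requires.\<close>
    then have x': "x' \<in> pverts D" "?d x' \<subseteq> ?d x"
      using sub[OF xy(1)] by (blast, force)
    obtain g where g: "automorphism g D" "g x = x'"
      using vt xy(1) x'(1) unfolding vertex_transitive_def by auto
    have img: "g ` ?d x = ?d x'" using automorphism_image_desc[OF wf g(1) xy(1)] g(2) by simp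
    let ?h = "\<lambda>v. if v \<in> ?d x then g v else v"
    have "vertex_isomorphism ?h (D \<restriction> (?d x \<union> ?d y)) (D \<restriction> (g ` ?d x \<union> ?d y))"
      by (rule vertex_isomorphism_glue[OF g(1)])
        (use sub xy closed img disj x' in \<open>simp_all only:\<close>, use disj x' in blast)
    moreover have "desc_set D {u, y} = ?d u \<union> ?d y" if "u \<in> pverts D" for u
      using that xy desc_eq_rtrancl_Image[OF wf acyc] by (simp add: desc_set_def)
    ultimately have "vertex_isomorphism ?h (D \<restriction> desc_set D {x, y}) (D \<restriction> desc_set D {x', y})"
      using xy x' img by simp
    \<comment> \<open>Agreement on the two generators \<open>x\<close> and \<open>y\<close> is all
      that homogeneity provides, and it suffices: \<open>k\<close> fixes \<open>y\<close> and moves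
      \<open>x\<close> to \<open>x'\<close>.\<close>
    then have "\<exists>k. automorphism k D \<and> (\<forall>v\<in>{x, y}. k v = ?h v)"
      using wdh xy x' unfolding weakly_descendant_homogeneous_def
      by (elim conjE allE[of _ "{x, y}"] allE[of _ "{x', y}"] allE[of _ ?h] mp) simp
    then obtain k where k: "automorphism k D" "\<forall>v\<in>{x, y}. k v = ?h v" by blast
    have "y \<notin> ?d x" using disj by blast
    then have "k x = x'" "k y = y" using k(2) g(2) by auto
    then show "x' \<in> {g x | g. automorphism g D \<and> g y = y}" using k(1) by blast
  qed
  moreover have "finite {g x | g. automorphism g D \<and> g y = y}"
    using finite_stabiliser_orbit[OF wf lf connected_imp_rtrancl[OF wf conn xy(2,1)]] .
  ultimately have "finite (?d x)" by (rule finite_subset)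
  moreover have "infinite (?d x)"
    by (rule infinite_rtrancl_Image[where V = "pverts D"]) (use acyc ran out xy in auto)
  ultimately show False by contradiction
qed

section \<open>Consequences of distance and vertex transitivity\<close>

lemma distance_transitive_walk_length_unique:
  fixes D :: "'a pair_pre_digraph"
  assumes wf: "pair_wf_digraph D" and lf: "locally_finite_digraph D"
    and dt: "distance_transitive D" and acyc: "acyclic (parcs D)"
    and st: "(u, v) \<in> parcs D ^^ s" "(u, v) \<in> parcs D ^^ t"
  shows "s = t"
proof (rule relpow_length_unique[OF acyc finite_neighbours(1)[OF wf lf] _ st])
  interpret pair_wf_digraph D by fact
  fix s t u v u' v'
  assume v: "v \<in> layer (parcs D) s u" and v': "v' \<in> layer (parcs D) s u'"
    and t: "(u, v) \<in> parcs D ^^ t"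
  show "(u', v') \<in> parcs D ^^ t"
  proof (cases "s = 0")
    \<comment> \<open>Radius 0 is treated apart: \<open>u\<close> need not be a vertex here, so
      \<open>at_distance\<close> may fail. For positive \<open>s\<close> the first edge of a walk
      shows that its start is a vertex.\<close>
    case True
    then have "u = v" "u' = v'" using v v' by (auto simp: layer_def)
    moreover have "t = 0"
      using t acyc \<open>u = v\<close> by (metis acyclic_def gr0I trancl_power)
    ultimately show ?thesis by simp
  next
    case False
    have pos: "a \<in> pverts D" if "b \<in> layer (parcs D) s a" for a b
    proof -
      obtain m where "s = Suc m" using False by (cases s) auto
      then have "(a, b) \<in> parcs D O parcs D ^^ m"
        using that by (simp add: layer_def relpow_commute)
      then show ?thesis using in_arcsD1 by auto
    qed
    have "at_distance D s a b" if "b \<in> layer (parcs D) s a" for a b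
      using s_arc_iff_relpow[OF wf acyc pos[OF that]] that
      by (simp add: at_distance_def layer_def)
    then obtain g where "automorphism g D" "g u = u'" "g v = v'"
      using dt v v' unfolding distance_transitive_def by meson
    then show ?thesis using automorphism_relpow[OF wf _ t] by metis
  qed
qed

text \<open>Two distinct vertices and connectedness force some edge; automorphisms then move its
  tail, respectively its head, to \<open>u\<close>.\<close>

lemma vertex_transitive_in_out:
  fixes D :: "'a pair_pre_digraph"
  assumes wf: "pair_wf_digraph D" and vt: "vertex_transitive D" and inf: "infinite (pverts D)"
    and conn: "connected D" and u: "u \<in> pverts D"
  shows "\<exists>v. (u, v) \<in> parcs D" "\<exists>v. (v, u) \<in> parcs D"
proof -
  interpret pair_wf_digraph D by fact
  have "infinite (pverts D - {u})" using inf by simp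
  then obtain w where "w \<in> pverts D" "w \<noteq> u" by (metis DiffE finite.emptyI equals0I singletonI)
  then have "parcs D \<noteq> {}" using connected_imp_rtrancl[OF wf conn u] by fastforce
  then obtain a b where ab: "(a, b) \<in> parcs D" by auto
  then have V: "a \<in> pverts D" "b \<in> pverts D" using in_arcsD1 in_arcsD2 by auto
  obtain g where g: "automorphism g D" "g a = u"
    using vt V(1) u unfolding vertex_transitive_def by auto
  obtain h where h: "automorphism h D" "h b = u"
    using vt V(2) u unfolding vertex_transitive_def by auto
  show "\<exists>v. (u, v) \<in> parcs D" using automorphismD(3)[OF g(1) V] ab g(2) by blast
  show "\<exists>v. (v, u) \<in> parcs D" using automorphismD(3)[OF h(1) V] ab h(2) by blast
qed

section \<open>The level function\<close>

theorem theorem1p2: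
  fixes D :: "'a pair_pre_digraph"
  assumes "pair_loopfree_digraph D"
    and "infinite (pverts D)"
    and "connected D"
    and "locally_finite_digraph D"
    and "distance_transitive D"
    and "\<not> (\<exists>us. directed_cycle D us)"
    and "weakly_descendant_homogeneous D"
  shows "property_Z D"
proof -
  interpret pair_loopfree_digraph D by fact
  have wf: "pair_wf_digraph D" by unfold_locales
  let ?R = "parcs D"
  have acyc: "acyclic ?R" using assms(6) by (rule acyclic_if_no_directed_cycle)
  have vt: "vertex_transitive D" using assms(7) by (simp add: weakly_descendant_homogeneous_def)
  note in_out = vertex_transitive_in_out[OF wf vt assms(2,3)]
  note unique = distance_transitive_walk_length_unique[OF wf assms(4,5) acyc]
  have common: "\<exists>z. (x, z) \<in> ?R\<^sup>* \<and> (y, z) \<in> ?R\<^sup>*" if "x \<in> pverts D" "y \<in> pverts D" for x y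
    using that by (rule common_descendant[OF wf assms(3,4) acyc assms(7), rotated]) (rule in_out(1))
  have ran: "Range ?R \<subseteq> pverts D" using in_arcsD2 by auto
  obtain b where b: "b \<in> pverts D" using assms(2) by (metis finite.emptyI equals0I)
  \<comment> \<open>A relation at first, since \<open>z\<close>, \<open>i\<close> and
    \<open>j\<close> involve choices. Values are integers because \<open>x\<close> may lie above
    \<open>b\<close>.\<close>
  define lev where "lev x n \<longleftrightarrow> (\<exists>z i j. (b, z) \<in> ?R ^^ i \<and> (x, z) \<in> ?R ^^ j \<and> n = int i - int j)"
    for x n
  have lev_ex: "\<exists>n. lev x n" if "x \<in> pverts D" for x
    using common[OF b that] unfolding lev_def rtrancl_power by blast
  have lev_unique: "m = n" if m: "lev x m" and n: "lev x n" and x: "x \<in> pverts D" for x m n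
  proof -
    obtain z i j where z: "(b, z) \<in> ?R ^^ i" "(x, z) \<in> ?R ^^ j" "m = int i - int j"
      using m unfolding lev_def by blast
    obtain z' i' j' where z': "(b, z') \<in> ?R ^^ i'" "(x, z') \<in> ?R ^^ j'" "n = int i' - int j'"
      using n unfolding lev_def by blast
    have "z \<in> pverts D" "z' \<in> pverts D"
      using rtrancl_closed[OF relpow_imp_rtrancl x ran] z(2) z'(2) by blast+
    then obtain w k k' where w: "(z, w) \<in> ?R ^^ k" "(z', w) \<in> ?R ^^ k'"
      using common unfolding rtrancl_power by blast
    \<comment> \<open>Both sides are lengths of walks from \<open>b\<close> to \<open>w\<close>, via
      \<open>z\<close> and via \<open>z'\<close>; likewise from \<open>x\<close> below. Subtracting
      the two equations removes \<open>k\<close> and \<open>k'\<close>.\<close>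
    have "i + k = i' + k'"
      by (rule unique[of b w]) (use z z' w in \<open>auto simp: relpow_add\<close>)
    moreover have "j + k = j' + k'"
      by (rule unique[of x w]) (use z z' w in \<open>auto simp: relpow_add\<close>)
    ultimately show ?thesis using z(3) z'(3) by linarith
  qed
  define f where "f x = (SOME n. lev x n)" for x
  have f: "f x = n" if "lev x n" "x \<in> pverts D" for x n
    using lev_unique[OF _ that] that(1) unfolding f_def by (metis someI)
  have step: "f v = f u + 1" if uv: "(u, v) \<in> ?R" for u v
  proof -
    have V: "u \<in> pverts D" "v \<in> pverts D" using uv in_arcsD1 in_arcsD2 by auto
    obtain z i j where z: "(b, z) \<in> ?R ^^ i" "(v, z) \<in> ?R ^^ j"
      using common[OF b V(2)] unfolding rtrancl_power by blast
    \<comment> \<open>The same \<open>z\<close> serves for \<open>u\<close>, one edge further away,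
      and this gives the increment 1.\<close>
    then have "(u, z) \<in> ?R ^^ Suc j" using uv by (metis relpow_Suc_I2)
    then have "lev u (int i - int (Suc j))" "lev v (int i - int j)"
      using z unfolding lev_def by blast+
    then show ?thesis using f V by simp
  qed
  \<comment> \<open>Starting from \<open>f b\<close>, out-neighbours reach all larger integers and
    in-neighbours all smaller ones.\<close>
  have "n \<in> f ` pverts D" for n
  proof (induction n rule: int_induct[where k = "f b"])
    case base
    then show ?case using b by blast
  next
    case (step1 i)
    then obtain u where u: "u \<in> pverts D" "i = f u" by blast
    then obtain v where "(u, v) \<in> ?R" using in_out(1) by blast
    then show ?case using step[of u v] u in_arcsD2 by (intro image_eqI[of _ _ v]) auto
  next
    case (step2 i)
    then obtain u where u: "u \<in> pverts D" "i = f u" by blast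
    then obtain v where "(v, u) \<in> ?R" using in_out(2) by blast
    then show ?case using step[of v u] u in_arcsD1 by (intro image_eqI[of _ _ v]) auto
  qed
  then have "f ` verts D = UNIV" by auto
  then show ?thesis unfolding property_Z_def using step by (intro exI[of _ f]) simp
qed

end
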